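(* Let $n\ge 1$ be an integer and let $U_{6n}=\langle a,b : a^{2n}=b^3=1,\ a^{-1}ba=b^{-1}\rangle$. Then each of the graphs $\Gamma=\mathrm{ESCom}(U_{6n})$, $\Gamma=\mathrm{CSCom}(U_{6n})$ and $\Gamma=\mathrm{OSCom}(U_{6n})$ satisfies the Hansen--Vukičević inequality \[ \frac{M_2(\Gamma)}{|e(\Gamma)|}\ \ge\ \frac{M_1(\Gamma)}{|v(\Gamma)|}. \]
   Context: For an equivalence relation $B$ on a finite group $G$, with $[g]$ the class of $g$, the $B$ super commuting graph of $G$ is the simple graph with vertex set $G$ in which two distinct vertices $g,h$ are adjacent if and only if $[g]=[h]$ or there exist $g'\in[g]$, $h'\in[h]$ with $g'h'=h'g'$. It is denoted $\mathrm{ESCom}(G)$ when $B$ is equality (so $g\ne h$ are adjacent iff $gh=hg$), $\mathrm{CSCom}(G)$ when $B$ is conjugacy in $G$, and $\mathrm{OSCom}(G)$ when $B$ is the relation of having the same order. For a finite simple graph $\Gamma$ with vertex set $v(\Gamma)$ and edge set $e(\Gamma)$, the first and second Zagreb indices are $M_1(\Gamma)=\sum_{v\in v(\Gamma)}\deg(v)^2$ and $M_2(\Gamma)=\sum_{uv\in e(\Gamma)}\deg(u)\deg(v)$. *)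

theory Defs
  imports Complex_Main "HOL-Algebra.Multiplicative_Group"
begin

section \<open>Groups given by generators and relations\<close>

text \<open>
  A word over a type of generators is a list of letters; the letter \<open>(x, False)\<close> stands for
  the generator \<open>x\<close> and \<open>(x, True)\<close> for its formal inverse. A relation \<open>l = r\<close> is a pair
  of words. The words modulo the congruence generated by free cancellation and the relations
  form the group presented by the relations.
\<close>

type_synonym 'g word = "('g \<times> bool) list"

inductive word_eq :: "('g word \<times> 'g word) set \<Rightarrow> 'g word \<Rightarrow> 'g word \<Rightarrow> bool"
  for R :: "('g word \<times> 'g word) set" where
  word_eq_refl: "word_eq R u u"
| word_eq_sym: "word_eq R u v \<Longrightarrow> word_eq R v u"
| word_eq_trans: "word_eq R u v \<Longrightarrow> word_eq R v w \<Longrightarrow> word_eq R u w"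
| word_eq_cancel: "word_eq R (u @ [(x, s), (x, \<not> s)] @ v) (u @ v)"
| word_eq_relation: "(l, r) \<in> R \<Longrightarrow> word_eq R (u @ l @ v) (u @ r @ v)"

definition word_class :: "('g word \<times> 'g word) set \<Rightarrow> 'g word \<Rightarrow> 'g word set" where
  "word_class R u = {v. word_eq R u v}"

definition presented_group :: "('g word \<times> 'g word) set \<Rightarrow> 'g word set monoid" where
  "presented_group R =
     \<lparr> carrier = range (word_class R),
       mult = (\<lambda>A B. \<Union>u\<in>A. \<Union>v\<in>B. word_class R (u @ v)),
       one = word_class R [] \<rparr>"

datatype gen = GenA | GenB

definition U6n :: "nat \<Rightarrow> gen word set monoid" where
  "U6n n = presented_group
     (let a = (GenA, False); a' = (GenA, True); b = (GenB, False); b' = (GenB, True)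
      in {(replicate (2 * n) a, []), (replicate 3 b, []), ([a', b, a], [b'])})"

lemma word_class_eq_iff: "word_class R u = word_class R v \<longleftrightarrow> word_eq R u v"
  unfolding word_class_def set_eq_iff mem_Collect_eq
  by (meson word_eq_refl word_eq_sym word_eq_trans)

lemma word_eq_context: "word_eq R u v \<Longrightarrow> word_eq R (p @ u @ q) (p @ v @ q)"
proof (induction rule: word_eq.induct)
  case (word_eq_cancel u x s v)
  show ?case using word_eq.word_eq_cancel[of R "p @ u" x s "v @ q"] by simp
next
  case (word_eq_relation l r u v)
  then show ?case using word_eq.word_eq_relation[of l r R "p @ u" "v @ q"] by simp
qed (blast intro: word_eq.intros)+

lemma word_eq_append:
  assumes "word_eq R u u'" "word_eq R v v'"
  shows "word_eq R (u @ v) (u' @ v')"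
proof -
  have "word_eq R (u @ v) (u' @ v)" using word_eq_context[OF assms(1), of "[]" v] by simp
  moreover have "word_eq R (u' @ v) (u' @ v')" using word_eq_context[OF assms(2), of u' "[]"] by simp
  ultimately show ?thesis by (rule word_eq_trans)
qed

lemma presented_group_mult:
  "word_class R u \<otimes>\<^bsub>presented_group R\<^esub> word_class R v = word_class R (u @ v)"
proof -
  have eq: "word_class R (x @ y) = word_class R (u @ v)"
    if "x \<in> word_class R u" "y \<in> word_class R v" for x y
  proof -
    have "word_eq R u x" "word_eq R v y" using that by (simp_all add: word_class_def)
    then have "word_eq R (x @ y) (u @ v)" by (intro word_eq_sym[OF word_eq_append])
    then show ?thesis by (simp add: word_class_eq_iff)
  qed
  have ne: "word_class R u \<noteq> {}" "word_class R v \<noteq> {}"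
    unfolding word_class_def using word_eq_refl by blast+
  have "(\<Union>x\<in>word_class R u. \<Union>y\<in>word_class R v. word_class R (x @ y))
      = (\<Union>x\<in>word_class R u. \<Union>y\<in>word_class R v. word_class R (u @ v))"
    by (intro SUP_cong refl) (rule eq)
  also have "\<dots> = word_class R (u @ v)" using ne by simp
  finally show ?thesis by (simp add: presented_group_def)
qed

definition word_inv :: "'g word \<Rightarrow> 'g word" where
  "word_inv u = rev (map (\<lambda>(x, s). (x, \<not> s)) u)"

lemma word_inv_left: "word_eq R (word_inv u @ u) []"
proof (induction u)
  case Nil
  then show ?case by (simp add: word_inv_def word_eq_refl)
next
  case (Cons l u)
  obtain x s where l: "l = (x, s)" by (cases l)
  have "word_eq R (word_inv (l # u) @ l # u) (word_inv u @ u)"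
    using word_eq_cancel[of R "word_inv u" x "\<not> s" u] by (simp add: word_inv_def l)
  then show ?case using Cons word_eq_trans by blast
qed

lemma group_presented_group: "group (presented_group R)"
proof (rule groupI)
  fix A assume "A \<in> carrier (presented_group R)"
  then obtain u where u: "A = word_class R u" by (auto simp: presented_group_def)
  have one: "\<one>\<^bsub>presented_group R\<^esub> = word_class R []" by (simp add: presented_group_def)
  show "\<one>\<^bsub>presented_group R\<^esub> \<otimes>\<^bsub>presented_group R\<^esub> A = A"
    by (simp add: one u presented_group_mult)
  have "word_class R (word_inv u) \<otimes>\<^bsub>presented_group R\<^esub> A = \<one>\<^bsub>presented_group R\<^esub>"
    by (simp add: one u presented_group_mult word_class_eq_iff word_inv_left)
  then show "\<exists>B\<in>carrier (presented_group R). B \<otimes>\<^bsub>presented_group R\<^esub> A = \<one>\<^bsub>presented_group R\<^esub>"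
    by (intro bexI[of _ "word_class R (word_inv u)"]) (auto simp: presented_group_def)
next
  fix A B assume "A \<in> carrier (presented_group R)" "B \<in> carrier (presented_group R)"
  then obtain u v where "A = word_class R u" "B = word_class R v"
    by (auto simp: presented_group_def)
  then show "A \<otimes>\<^bsub>presented_group R\<^esub> B \<in> carrier (presented_group R)"
    by (simp add: presented_group_mult) (simp add: presented_group_def)
next
  fix A B C
  assume "A \<in> carrier (presented_group R)" "B \<in> carrier (presented_group R)"
    "C \<in> carrier (presented_group R)"
  then obtain u v w where "A = word_class R u" "B = word_class R v" "C = word_class R w"
    by (auto simp: presented_group_def)
  then show "A \<otimes>\<^bsub>presented_group R\<^esub> B \<otimes>\<^bsub>presented_group R\<^esub> C
      = A \<otimes>\<^bsub>presented_group R\<^esub> (B \<otimes>\<^bsub>presented_group R\<^esub> C)"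
    by (simp add: presented_group_mult)
qed (simp add: presented_group_def)

lemma group_U6n: "group (U6n n)"
  unfolding U6n_def by (rule group_presented_group)

section \<open>Simple graphs and Zagreb indices\<close>

text \<open>An edge is the two-element set of its endpoints.\<close>

record 'a sgraph =
  vertices :: "'a set"
  edges :: "'a set set"

definition degree :: "'a sgraph \<Rightarrow> 'a \<Rightarrow> nat" where
  "degree \<Gamma> v = card {e \<in> edges \<Gamma>. v \<in> e}"

definition zagreb1 :: "'a sgraph \<Rightarrow> nat" where
  "zagreb1 \<Gamma> = (\<Sum>v\<in>vertices \<Gamma>. (degree \<Gamma> v)\<^sup>2)"

text \<open>For an edge \<open>e = {u, v}\<close> the inner product is \<open>degree \<Gamma> u * degree \<Gamma> v\<close>.\<close>

definition zagreb2 :: "'a sgraph \<Rightarrow> nat" where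
  "zagreb2 \<Gamma> = (\<Sum>e\<in>edges \<Gamma>. \<Prod>v\<in>e. degree \<Gamma> v)"

section \<open>Super commuting graphs\<close>

text \<open>The relation \<open>B\<close> is meant to be an equivalence relation on the carrier of \<open>G\<close>, so that
  \<open>B `` {g}\<close> is the class of \<open>g\<close>.\<close>

definition super_commuting_graph :: "('a, 'm) monoid_scheme \<Rightarrow> 'a rel \<Rightarrow> 'a sgraph" where
  "super_commuting_graph G B =
     \<lparr> vertices = carrier G,
       edges = {{g, h} | g h. g \<in> carrier G \<and> h \<in> carrier G \<and> g \<noteq> h \<and>
         (B `` {g} = B `` {h} \<or>
          (\<exists>g'\<in>B `` {g}. \<exists>h'\<in>B `` {h}. g' \<otimes>\<^bsub>G\<^esub> h' = h' \<otimes>\<^bsub>G\<^esub> g'))} \<rparr>"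

definition conjugacy_rel :: "('a, 'm) monoid_scheme \<Rightarrow> 'a rel" where
  "conjugacy_rel G = {(g, h). g \<in> carrier G \<and> h \<in> carrier G \<and>
     (\<exists>x\<in>carrier G. h = x \<otimes>\<^bsub>G\<^esub> g \<otimes>\<^bsub>G\<^esub> inv\<^bsub>G\<^esub> x)}"

definition same_order_rel :: "('a, 'm) monoid_scheme \<Rightarrow> 'a rel" where
  "same_order_rel G = {(g, h). g \<in> carrier G \<and> h \<in> carrier G \<and> group.ord G g = group.ord G h}"

definition ESCom :: "('a, 'm) monoid_scheme \<Rightarrow> 'a sgraph" where
  "ESCom G = super_commuting_graph G (Id_on (carrier G))"

definition CSCom :: "('a, 'm) monoid_scheme \<Rightarrow> 'a sgraph" where
  "CSCom G = super_commuting_graph G (conjugacy_rel G)"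

definition OSCom :: "('a, 'm) monoid_scheme \<Rightarrow> 'a sgraph" where
  "OSCom G = super_commuting_graph G (same_order_rel G)"

end

theory Submission
  imports Defs
begin

text \<open>
  Write \<open>d\<close> for the degree and \<open>N\<close> for the number of vertices. Expanding the squares gives, for every
  finite simple graph,
  \<open>\<Sum>u. \<Sum>v. (d u - d v)\<^sup>2 * (d u + d v - N * adj u v) = 4 * (N * M\<^sub>2 - \<bar>e\<bar> * M\<^sub>1)\<close>,
  where \<open>adj\<close> is the \<open>0\<close>-\<open>1\<close> adjacency function. So the inequality holds as soon as every edge
  whose ends have different degrees has degree sum at least \<open>N\<close>, because then no term is negative
  (\<open>hansen_vukicevic\<close>). Two kinds of edges are always harmless: those with an end adjacent to all
  vertices (degree sum at least \<open>(N - 1) + 1\<close>), and those joining vertices with the same closed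
  neighbourhood (equal degrees).

  All three graphs have only such edges, and no degree has to be computed. In \<open>U\<^sub>6\<^sub>n\<close> the elements
  \<open>a\<^sup>i b\<^sup>j\<close> with \<open>i\<close> even form an abelian subgroup \<open>A\<close> of index two. In a group with such
  a subgroup, an element of \<open>A\<close> that commutes with some element outside \<open>A\<close> is central. Let the
  classes of \<open>B\<close> not cross the border of \<open>A\<close>. Then an element of \<open>A\<close> is adjacent to everything
  if its class contains a central element, and has closed neighbourhood exactly \<open>A\<close> otherwise. It remains to see that adjacency is transitive
  outside \<open>A\<close> (\<open>hansen_vukicevic_super_commuting_graph\<close>). For equality this is a general fact about
  abelian subgroups of index two. For conjugacy and for equal order it is trivial in \<open>U\<^sub>6\<^sub>n\<close>,
  since every element outside \<open>A\<close> is conjugate to a power of \<open>a\<close>, so that any two of them are adjacent.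

  That \<open>A\<close> is a union of order classes follows from the description \<open>A = {g. g\<^sup>3\<^sup>n = 1}\<close>. Here the
  presentation enters: modulo \<open>2n\<close> the exponent sum of \<open>a\<close> in a word depends only on the element of
  the group that the word represents, and an odd exponent sum \<open>e\<close> cannot satisfy \<open>3n e = 0\<close> modulo \<open>2n\<close>.
\<close>

section \<open>The inequality for graphs whose edges have balanced or large degrees\<close>

locale finite_simple_graph =
  fixes \<Gamma> :: "'a sgraph"
  assumes finite_vertices: "finite (vertices \<Gamma>)"
    and simple: "e \<in> edges \<Gamma> \<Longrightarrow> \<exists>u v. u \<in> vertices \<Gamma> \<and> v \<in> vertices \<Gamma> \<and> u \<noteq> v \<and> e = {u, v}"
begin

definition neighbours :: "'a \<Rightarrow> 'a set" where
  "neighbours v = {u \<in> vertices \<Gamma>. {v, u} \<in> edges \<Gamma>}"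

lemma edge_ends:
  assumes "{u, v} \<in> edges \<Gamma>"
  shows "u \<in> vertices \<Gamma>" "v \<in> vertices \<Gamma>" "u \<noteq> v"
  using simple[OF assms] by (auto simp: doubleton_eq_iff)

lemma finite_neighbours: "finite (neighbours v)"
  using finite_vertices by (simp add: neighbours_def)

lemma finite_edges: "finite (edges \<Gamma>)"
proof (rule finite_subset)
  show "edges \<Gamma> \<subseteq> Pow (vertices \<Gamma>)" using simple by blast
qed (simp add: finite_vertices)

lemma degree_eq_card_neighbours: "degree \<Gamma> v = card (neighbours v)"
proof -
  have "{e \<in> edges \<Gamma>. v \<in> e} = (\<lambda>u. {v, u}) ` neighbours v"
  proof (intro equalityI subsetI)
    fix e assume e: "e \<in> {e \<in> edges \<Gamma>. v \<in> e}"
    then obtain x y where "e = {x, y}" using simple by blast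
    with e obtain u where "e = {v, u}" by (auto simp: insert_commute)
    with e show "e \<in> (\<lambda>u. {v, u}) ` neighbours v"
      using edge_ends by (auto simp: neighbours_def)
  qed (auto simp: neighbours_def)
  moreover have "inj_on (\<lambda>u. {v, u}) (neighbours v)"
    by (auto simp: inj_on_def doubleton_eq_iff)
  ultimately show ?thesis by (simp add: degree_def card_image)
qed

text \<open>Every edge arises from exactly two ordered pairs of adjacent vertices.\<close>

lemma sum_over_ordered_edges:
  fixes f :: "'a set \<Rightarrow> real"
  shows "(\<Sum>v\<in>vertices \<Gamma>. \<Sum>u\<in>neighbours v. f {v, u}) = 2 * (\<Sum>e\<in>edges \<Gamma>. f e)"
proof -
  define P where "P = Sigma (vertices \<Gamma>) neighbours"
  have fin: "finite P" unfolding P_def using finite_vertices finite_neighbours by simp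
  have img: "(\<lambda>(v, u). {v, u}) ` P = edges \<Gamma>"
  proof (intro equalityI subsetI)
    fix e assume "e \<in> edges \<Gamma>"
    then show "e \<in> (\<lambda>(v, u). {v, u}) ` P"
      using simple[of e] by (force simp: P_def neighbours_def image_iff)
  qed (auto simp: P_def neighbours_def)
  have fibre: "(\<Sum>p | p \<in> P \<and> (\<lambda>(v, u). {v, u}) p = e. f ((\<lambda>(v, u). {v, u}) p)) = 2 * f e"
    if e: "e \<in> edges \<Gamma>" for e
  proof -
    obtain x y where xy: "x \<in> vertices \<Gamma>" "y \<in> vertices \<Gamma>" "x \<noteq> y" "e = {x, y}"
      using simple[OF e] by blast
    have "{p. p \<in> P \<and> (\<lambda>(v, u). {v, u}) p = e} = {(x, y), (y, x)}"
      using xy e by (auto simp: P_def neighbours_def doubleton_eq_iff insert_commute)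
    then show ?thesis using xy by (simp add: insert_commute)
  qed
  have "(\<Sum>v\<in>vertices \<Gamma>. \<Sum>u\<in>neighbours v. f {v, u}) = (\<Sum>p\<in>P. f ((\<lambda>(v, u). {v, u}) p))"
    unfolding P_def using finite_vertices finite_neighbours
    by (subst sum.Sigma) (auto intro: sum.cong)
  also have "\<dots> = (\<Sum>e\<in>edges \<Gamma>. 2 * f e)"
    by (subst sum.image_gen[OF fin, where g = "\<lambda>(v, u). {v, u}"])
       (use img fibre in \<open>auto intro: sum.cong\<close>)
  finally show ?thesis by (simp add: sum_distrib_left)
qed

text \<open>
  The terms \<open>(d u - d v)\<^sup>2 * (d u + d v - N * adj u v)\<close> are nonnegative: for adjacent \<open>u\<close>, \<open>v\<close> by
  hypothesis, otherwise because the last factor is a sum of degrees. In their sum the cubes of the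
  degrees cancel, since \<open>\<Sum>v. adj u v = d u\<close> turns \<open>adj u v * (d u)\<^sup>2\<close> into \<open>(d u)\<^sup>3\<close>; what remains is
  a multiple of \<open>N * M\<^sub>2 - \<bar>e\<bar> * M\<^sub>1\<close>.
\<close>

theorem hansen_vukicevic:
  assumes edge: "\<And>u v. {u, v} \<in> edges \<Gamma> \<Longrightarrow>
    degree \<Gamma> u = degree \<Gamma> v \<or> card (vertices \<Gamma>) \<le> degree \<Gamma> u + degree \<Gamma> v"
  shows "real (zagreb2 \<Gamma>) / real (card (edges \<Gamma>)) \<ge> real (zagreb1 \<Gamma>) / real (card (vertices \<Gamma>))"
proof (cases "edges \<Gamma> = {}")
  case True
  then show ?thesis by (simp add: zagreb1_def degree_def)
next
  case False
  let ?V = "vertices \<Gamma>"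
  define N where "N = real (card ?V)"
  define d where "d v = real (degree \<Gamma> v)" for v
  define adj where "adj u v = (if v \<in> neighbours u then 1 else 0 :: real)" for u v
  define S where "S = (\<Sum>v\<in>?V. d v)"
  define S2 where "S2 = (\<Sum>v\<in>?V. d v ^ 2)"
  define S3 where "S3 = (\<Sum>v\<in>?V. d v ^ 3)"
  have adj_sum: "(\<Sum>v\<in>?V. adj u v * f v) = (\<Sum>v\<in>neighbours u. f v)" for u and f :: "'a \<Rightarrow> real"
  proof -
    have "(\<Sum>v\<in>?V. adj u v * f v) = (\<Sum>v\<in>?V. if v \<in> neighbours u then f v else 0)"
      by (rule sum.cong) (auto simp: adj_def)
    also have "\<dots> = (\<Sum>v\<in>?V \<inter> neighbours u. f v)"
      by (simp add: sum.inter_restrict finite_vertices)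
    also have "?V \<inter> neighbours u = neighbours u" by (auto simp: neighbours_def)
    finally show ?thesis .
  qed
  have adj_deg: "(\<Sum>v\<in>?V. adj u v) = d u" for u
    using adj_sum[of u "\<lambda>_. 1"] by (simp add: d_def degree_eq_card_neighbours)
  have adj_sym: "adj u v = adj v u" if "u \<in> ?V" "v \<in> ?V" for u v
    using that by (simp add: adj_def neighbours_def insert_commute)
  have S_edges: "S = 2 * real (card (edges \<Gamma>))"
    using sum_over_ordered_edges[of "\<lambda>_. 1"]
    by (simp add: S_def d_def degree_eq_card_neighbours)
  have M1: "real (zagreb1 \<Gamma>) = S2" by (simp add: zagreb1_def S2_def d_def)
  have M2: "(\<Sum>u\<in>?V. \<Sum>v\<in>?V. adj u v * (d u * d v)) = 2 * real (zagreb2 \<Gamma>)"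
  proof -
    have "(\<Sum>v\<in>?V. adj u v * (d u * d v)) = (\<Sum>v\<in>neighbours u. \<Prod>w\<in>{u, v}. d w)" for u
      unfolding adj_sum
    proof (rule sum.cong)
      fix v assume "v \<in> neighbours u"
      then have "u \<noteq> v" using edge_ends(3) by (auto simp: neighbours_def)
      then show "d u * d v = (\<Prod>w\<in>{u, v}. d w)" by simp
    qed simp
    then have "(\<Sum>u\<in>?V. \<Sum>v\<in>?V. adj u v * (d u * d v)) = 2 * (\<Sum>e\<in>edges \<Gamma>. \<Prod>w\<in>e. d w)"
      using sum_over_ordered_edges[of "\<lambda>e. \<Prod>w\<in>e. d w"] by simp
    then show ?thesis by (simp add: zagreb2_def d_def)
  qed
  have S3_left: "(\<Sum>u\<in>?V. \<Sum>v\<in>?V. adj u v * d u ^ 2) = S3"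
    by (simp add: sum_distrib_right[symmetric] adj_deg S3_def power3_eq_cube power2_eq_square mult.assoc)
  have S3_right: "(\<Sum>u\<in>?V. \<Sum>v\<in>?V. adj u v * d v ^ 2) = S3"
    unfolding S3_left[symmetric] by (subst sum.swap) (intro sum.cong refl, simp add: adj_sym)
  have nonneg: "0 \<le> (d u - d v)\<^sup>2 * (d u + d v - N * adj u v)" for u v
  proof (cases "v \<in> neighbours u")
    case True
    then have "d u = d v \<or> N \<le> d u + d v"
      using edge[of u v] by (auto simp: neighbours_def d_def N_def)
    then show ?thesis using True by (auto simp: adj_def)
  qed (simp add: adj_def d_def)
  have "0 \<le> (\<Sum>u\<in>?V. \<Sum>v\<in>?V. (d u - d v)\<^sup>2 * (d u + d v - N * adj u v))"
    by (intro sum_nonneg nonneg)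
  also have "\<dots> = (\<Sum>u\<in>?V. \<Sum>v\<in>?V. (d u ^ 3 + d v ^ 3 - d u ^ 2 * d v - d u * d v ^ 2)
      - N * (adj u v * d u ^ 2 + adj u v * d v ^ 2 - 2 * (adj u v * (d u * d v))))"
    by (intro sum.cong refl) (simp add: algebra_simps power2_eq_square power3_eq_cube)
  also have "\<dots> = (\<Sum>u\<in>?V. \<Sum>v\<in>?V. d u ^ 3) + (\<Sum>u\<in>?V. \<Sum>v\<in>?V. d v ^ 3)
      - (\<Sum>u\<in>?V. \<Sum>v\<in>?V. d u ^ 2 * d v) - (\<Sum>u\<in>?V. \<Sum>v\<in>?V. d u * d v ^ 2)
      - N * ((\<Sum>u\<in>?V. \<Sum>v\<in>?V. adj u v * d u ^ 2) + (\<Sum>u\<in>?V. \<Sum>v\<in>?V. adj u v * d v ^ 2)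
          - 2 * (\<Sum>u\<in>?V. \<Sum>v\<in>?V. adj u v * (d u * d v)))"
    by (simp add: sum.distrib sum_subtractf sum_distrib_left[symmetric])
  also have "\<dots> = 2 * N * S3 - 2 * S * S2 - N * (2 * S3 - 4 * real (zagreb2 \<Gamma>))"
  proof -
    have "(\<Sum>u\<in>?V. \<Sum>v\<in>?V. d u ^ 3) = N * S3"
      by (simp add: N_def S3_def sum_distrib_left)
    moreover have "(\<Sum>u\<in>?V. \<Sum>v\<in>?V. d v ^ 3) = N * S3"
      by (simp add: N_def S3_def)
    moreover have "(\<Sum>u\<in>?V. \<Sum>v\<in>?V. d u ^ 2 * d v) = S2 * S"
      by (simp add: S_def S2_def sum_product)
    moreover have "(\<Sum>u\<in>?V. \<Sum>v\<in>?V. d u * d v ^ 2) = S * S2"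
      by (simp add: S_def S2_def sum_product)
    ultimately show ?thesis unfolding S3_left S3_right M2 by (simp add: algebra_simps)
  qed
  also have "\<dots> = 4 * (N * real (zagreb2 \<Gamma>) - real (card (edges \<Gamma>)) * real (zagreb1 \<Gamma>))"
    unfolding S_edges M1 by (simp add: algebra_simps)
  finally have main: "real (card (edges \<Gamma>)) * real (zagreb1 \<Gamma>) \<le> N * real (zagreb2 \<Gamma>)" by simp
  have "0 < card (edges \<Gamma>)" using False finite_edges by (simp add: card_gt_0_iff)
  moreover have "0 < card ?V"
    using False simple finite_vertices by (fastforce simp: card_gt_0_iff)
  ultimately show ?thesis using main by (simp add: N_def divide_simps mult.commute)
qed

text \<open>
  A vertex adjacent to all others has degree \<open>N - 1\<close>, and the other end of an edge has positive degree,
  so the degree sum reaches \<open>N\<close>. Adjacent vertices with the same further neighbours have equal degree.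
\<close>

corollary hansen_vukicevic_dominating_or_twins:
  assumes edge: "\<And>u v. {u, v} \<in> edges \<Gamma> \<Longrightarrow>
    (\<forall>w\<in>vertices \<Gamma> - {u}. {u, w} \<in> edges \<Gamma>) \<or> (\<forall>w\<in>vertices \<Gamma> - {v}. {v, w} \<in> edges \<Gamma>) \<or>
    (\<forall>w\<in>vertices \<Gamma> - {u, v}. {u, w} \<in> edges \<Gamma> \<longleftrightarrow> {v, w} \<in> edges \<Gamma>)"
  shows "real (zagreb2 \<Gamma>) / real (card (edges \<Gamma>)) \<ge> real (zagreb1 \<Gamma>) / real (card (vertices \<Gamma>))"
proof (rule hansen_vukicevic)
  have dominating: "card (vertices \<Gamma>) \<le> degree \<Gamma> u + degree \<Gamma> v"
    if uv: "{u, v} \<in> edges \<Gamma>" and dom: "\<forall>w\<in>vertices \<Gamma> - {u}. {u, w} \<in> edges \<Gamma>" for u v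
  proof -
    have "neighbours u = vertices \<Gamma> - {u}"
      using dom edge_ends(3) by (auto simp: neighbours_def)
    then have "degree \<Gamma> u = card (vertices \<Gamma>) - 1"
      using edge_ends[OF uv] finite_vertices by (simp add: degree_eq_card_neighbours)
    moreover have "u \<in> neighbours v"
      using uv edge_ends[OF uv] by (simp add: neighbours_def insert_commute)
    then have "0 < degree \<Gamma> v"
      using finite_neighbours by (auto simp: degree_eq_card_neighbours card_gt_0_iff)
    ultimately show ?thesis by linarith
  qed
  fix u v assume uv: "{u, v} \<in> edges \<Gamma>"
  then have vu: "{v, u} \<in> edges \<Gamma>" by (simp add: insert_commute)
  consider "\<forall>w\<in>vertices \<Gamma> - {u}. {u, w} \<in> edges \<Gamma>" | "\<forall>w\<in>vertices \<Gamma> - {v}. {v, w} \<in> edges \<Gamma>"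
    | "\<forall>w\<in>vertices \<Gamma> - {u, v}. {u, w} \<in> edges \<Gamma> \<longleftrightarrow> {v, w} \<in> edges \<Gamma>"
    using edge[OF uv] by blast
  then show "degree \<Gamma> u = degree \<Gamma> v \<or> card (vertices \<Gamma>) \<le> degree \<Gamma> u + degree \<Gamma> v"
  proof cases
    case 1
    then show ?thesis using dominating[OF uv] by blast
  next
    case 2
    then show ?thesis using dominating[OF vu] by linarith
  next
    case 3
    have "insert u (neighbours u) = insert v (neighbours v)"
      using 3 uv vu edge_ends[OF uv] by (auto simp: neighbours_def)
    moreover have "x \<notin> neighbours x" for x using edge_ends(3)[of x x] by (auto simp: neighbours_def)
    ultimately have "Suc (card (neighbours u)) = Suc (card (neighbours v))"
      using finite_neighbours by (metis card_insert_disjoint)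
    then show ?thesis by (simp add: degree_eq_card_neighbours)
  qed
qed

end

section \<open>Super commuting graphs over an abelian subgroup of index two\<close>

definition class_commuting :: "('a, 'm) monoid_scheme \<Rightarrow> 'a rel \<Rightarrow> 'a \<Rightarrow> 'a \<Rightarrow> bool" where
  "class_commuting G B g h \<longleftrightarrow>
    (\<exists>g'\<in>B `` {g}. \<exists>h'\<in>B `` {h}. g' \<otimes>\<^bsub>G\<^esub> h' = h' \<otimes>\<^bsub>G\<^esub> g')"

lemma class_commuting_sym: "class_commuting G B g h \<Longrightarrow> class_commuting G B h g"
  unfolding class_commuting_def by metis

lemma vertices_super_commuting_graph [simp]: "vertices (super_commuting_graph G B) = carrier G"
  by (simp add: super_commuting_graph_def)

text \<open>
  If \<open>B\<close> is reflexive, elements \<open>g\<close> and \<open>h\<close> with the same class share the representative \<open>g\<close>, which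
  commutes with itself. So the first alternative in the adjacency condition is absorbed by the second.
\<close>

lemma edge_super_commuting_graph_iff:
  assumes "\<And>g. g \<in> carrier G \<Longrightarrow> (g, g) \<in> B"
  shows "{g, h} \<in> edges (super_commuting_graph G B) \<longleftrightarrow>
    g \<in> carrier G \<and> h \<in> carrier G \<and> g \<noteq> h \<and> class_commuting G B g h"
proof -
  have "class_commuting G B x y" if "x \<in> carrier G" "B `` {x} = B `` {y}" for x y
    using assms[OF that(1)] that(2) unfolding class_commuting_def by blast
  then show ?thesis
    unfolding super_commuting_graph_def class_commuting_def[symmetric]
    by (auto simp: doubleton_eq_iff dest: class_commuting_sym)
qed

text \<open>
  The hypothesis \<open>index2\<close> says that \<open>carrier G = A \<union> h A\<close> for each \<open>h\<close> outside \<open>A\<close>, and \<open>t\<close> commutes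
  with both \<open>h\<close> and the elements of \<open>A\<close>.
\<close>

lemma (in group) commutes_with_outside_imp_central:
  assumes A: "A \<subseteq> carrier G" "\<And>x y. x \<in> A \<Longrightarrow> y \<in> A \<Longrightarrow> x \<otimes> y = y \<otimes> x"
    and index2: "\<And>x y. x \<in> carrier G - A \<Longrightarrow> y \<in> carrier G - A \<Longrightarrow> inv x \<otimes> y \<in> A"
    and t: "t \<in> A" "h \<in> carrier G - A" "t \<otimes> h = h \<otimes> t"
    and x: "x \<in> carrier G"
  shows "t \<otimes> x = x \<otimes> t"
proof (cases "x \<in> A")
  case True
  then show ?thesis using A(2) t by blast
next
  case False
  have car: "t \<in> carrier G" "h \<in> carrier G" using t A by auto
  define s where "s = inv h \<otimes> x"
  have s: "s \<in> A" using index2 False t x by (simp add: s_def)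
  then have scar: "s \<in> carrier G" using A by auto
  have xs: "x = h \<otimes> s" using car x by (simp add: s_def m_assoc[symmetric])
  have "t \<otimes> x = h \<otimes> (t \<otimes> s)" using car scar t(3) by (simp add: xs m_assoc[symmetric])
  also have "\<dots> = x \<otimes> t" using A(2)[OF t(1) s] car scar by (simp add: xs m_assoc)
  finally show ?thesis .
qed

text \<open>
  Let \<open>g\<close> and \<open>h\<close> be adjacent and neither of them adjacent to everything. If one of them lies in \<open>A\<close>,
  both have closed neighbourhood \<open>A\<close>. If both lie outside \<open>A\<close>, their neighbours in \<open>A\<close> are elements
  adjacent to everything, hence common, and their neighbours outside \<open>A\<close> agree by transitivity.
\<close>

theorem (in group) hansen_vukicevic_super_commuting_graph:
  assumes fin: "finite (carrier G)"
    and A: "A \<subseteq> carrier G" "\<And>x y. x \<in> A \<Longrightarrow> y \<in> A \<Longrightarrow> x \<otimes> y = y \<otimes> x"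
    and index2: "\<And>x y. x \<in> carrier G - A \<Longrightarrow> y \<in> carrier G - A \<Longrightarrow> inv x \<otimes> y \<in> A"
    and B: "B \<subseteq> carrier G \<times> carrier G" "\<And>g. g \<in> carrier G \<Longrightarrow> (g, g) \<in> B"
    and saturated: "\<And>g h. (g, h) \<in> B \<Longrightarrow> g \<in> A \<longleftrightarrow> h \<in> A"
    and trans_outside: "\<And>g h k. g \<in> carrier G - A \<Longrightarrow> h \<in> carrier G - A \<Longrightarrow> k \<in> carrier G - A \<Longrightarrow>
      class_commuting G B g h \<Longrightarrow> class_commuting G B h k \<Longrightarrow> class_commuting G B g k"
  defines "\<Gamma> \<equiv> super_commuting_graph G B"
  shows "real (zagreb2 \<Gamma>) / real (card (edges \<Gamma>)) \<ge> real (zagreb1 \<Gamma>) / real (card (vertices \<Gamma>))"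
proof -
  let ?E = "class_commuting G B"
  have edge_iff: "{g, h} \<in> edges \<Gamma> \<longleftrightarrow> g \<in> carrier G \<and> h \<in> carrier G \<and> g \<noteq> h \<and> ?E g h" for g h
    unfolding \<Gamma>_def by (rule edge_super_commuting_graph_iff) (rule B(2))
  have vertices: "vertices \<Gamma> = carrier G" by (simp add: \<Gamma>_def)
  interpret finite_simple_graph \<Gamma>
  proof
    show "finite (vertices \<Gamma>)" by (simp add: vertices fin)
    fix e assume "e \<in> edges \<Gamma>"
    then show "\<exists>u v. u \<in> vertices \<Gamma> \<and> v \<in> vertices \<Gamma> \<and> u \<noteq> v \<and> e = {u, v}"
      unfolding \<Gamma>_def super_commuting_graph_def by auto
  qed
  define dom where "dom g \<longleftrightarrow> (\<forall>w\<in>carrier G. ?E g w)" for g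
  \<comment> \<open>a representative of \<open>g\<close> commuting with something outside \<open>A\<close> would be central and make \<open>g\<close> adjacent to everything\<close>
  have inside: "?E g k \<longleftrightarrow> k \<in> A" if g: "g \<in> A" "\<not> dom g" and k: "k \<in> carrier G" for g k
  proof
    assume "k \<in> A"
    then show "?E g k"
      unfolding class_commuting_def using B(2) A g(1) by blast
  next
    assume "?E g k"
    then obtain g' k' where g': "(g, g') \<in> B" and k': "(k, k') \<in> B" and comm: "g' \<otimes> k' = k' \<otimes> g'"
      unfolding class_commuting_def by blast
    show "k \<in> A"
    proof (rule ccontr)
      assume "k \<notin> A"
      then have "k' \<in> carrier G - A" "g' \<in> A" using saturated g' k' g(1) B(1) by auto
      then have "g' \<otimes> x = x \<otimes> g'" if "x \<in> carrier G" for x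
        using commutes_with_outside_imp_central[OF A index2 _ _ comm that] by blast
      then have "dom g" unfolding dom_def class_commuting_def using g' B(2) by blast
      with g(2) show False ..
    qed
  qed
  have sym: "?E h g" if "?E g h" for g h
    using that by (rule class_commuting_sym)
  have twins: "?E h k"
    if gh: "g \<in> carrier G" "h \<in> carrier G" "?E g h" "\<not> dom g" "\<not> dom h"
      and k: "k \<in> carrier G" "?E g k" for g h k
  proof (cases "g \<in> A")
    case True
    then have "h \<in> A" "k \<in> A" using inside gh k by blast+
    then show ?thesis using inside gh k by blast
  next
    case False
    then have h: "h \<notin> A" using inside[of h g] gh sym[of g h] by blast
    show ?thesis
    proof (cases "k \<in> A")
      case True
      then have "dom k" using inside[of k g] gh False k sym[of g k] by blast
      then show ?thesis using gh(2) sym[of k h] unfolding dom_def by blast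
    next
      case kA: False
      show ?thesis
        using trans_outside[of h g k] False h kA gh k sym[of g h] by blast
    qed
  qed
  show ?thesis
  proof (rule hansen_vukicevic_dominating_or_twins)
    fix g h assume gh: "{g, h} \<in> edges \<Gamma>"
    then have gh': "g \<in> carrier G" "h \<in> carrier G" "?E g h" "?E h g"
      using class_commuting_sym by (auto simp: edge_iff)
    show "(\<forall>w\<in>vertices \<Gamma> - {g}. {g, w} \<in> edges \<Gamma>) \<or> (\<forall>w\<in>vertices \<Gamma> - {h}. {h, w} \<in> edges \<Gamma>) \<or>
      (\<forall>w\<in>vertices \<Gamma> - {g, h}. {g, w} \<in> edges \<Gamma> \<longleftrightarrow> {h, w} \<in> edges \<Gamma>)"
    proof (cases "dom g \<or> dom h")
      case True
      then show ?thesis using gh' by (auto simp: vertices edge_iff dom_def)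
    next
      case False
      then have "?E g w \<longleftrightarrow> ?E h w" if "w \<in> carrier G" for w
        using twins[of g h w] twins[of h g w] gh' that by blast
      then show ?thesis using gh' by (auto simp: vertices edge_iff)
    qed
  qed
qed

text \<open>
  Commuting is transitive outside \<open>A\<close>: if \<open>g\<close> commutes with \<open>h\<close>, then so does \<open>t = h\<^sup>-\<^sup>1 g \<in> A\<close>, which is
  therefore central, and \<open>g = h t\<close> commutes with everything that \<open>h\<close> commutes with.
\<close>

corollary (in group) hansen_vukicevic_ESCom:
  assumes fin: "finite (carrier G)"
    and A: "A \<subseteq> carrier G" "\<And>x y. x \<in> A \<Longrightarrow> y \<in> A \<Longrightarrow> x \<otimes> y = y \<otimes> x"
    and index2: "\<And>x y. x \<in> carrier G - A \<Longrightarrow> y \<in> carrier G - A \<Longrightarrow> inv x \<otimes> y \<in> A"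
  defines "\<Gamma> \<equiv> ESCom G"
  shows "real (zagreb2 \<Gamma>) / real (card (edges \<Gamma>)) \<ge> real (zagreb1 \<Gamma>) / real (card (vertices \<Gamma>))"
  unfolding \<Gamma>_def ESCom_def
proof (rule hansen_vukicevic_super_commuting_graph[OF fin A index2])
  fix g h k
  assume g: "g \<in> carrier G - A" and h: "h \<in> carrier G - A" and k: "k \<in> carrier G - A"
    and gh: "class_commuting G (Id_on (carrier G)) g h"
    and hk: "class_commuting G (Id_on (carrier G)) h k"
  have gh': "g \<otimes> h = h \<otimes> g" and hk': "h \<otimes> k = k \<otimes> h"
    using gh hk by (auto simp: class_commuting_def)
  define t where "t = inv h \<otimes> g"
  have t: "t \<in> A" using index2 g h by (simp add: t_def)
  have car: "g \<in> carrier G" "h \<in> carrier G" "k \<in> carrier G" "t \<in> carrier G" using g h k t A by auto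
  have g_eq: "g = h \<otimes> t" using car by (simp add: t_def m_assoc[symmetric])
  have "h \<otimes> (t \<otimes> h) = h \<otimes> (h \<otimes> t)" using gh' car by (simp add: g_eq m_assoc)
  then have "t \<otimes> h = h \<otimes> t" using car by simp
  then have tk: "t \<otimes> k = k \<otimes> t"
    using commutes_with_outside_imp_central[OF A index2 t h] car by blast
  have "g \<otimes> k = h \<otimes> k \<otimes> t" using car tk by (simp add: g_eq m_assoc)
  also have "\<dots> = k \<otimes> g" using car hk' by (simp add: g_eq m_assoc)
  finally show "class_commuting G (Id_on (carrier G)) g k"
    using car by (auto simp: class_commuting_def)
qed auto

section \<open>The groups \<open>U\<^sub>6\<^sub>n\<close>\<close>

definition U6n_relations :: "nat \<Rightarrow> (gen word \<times> gen word) set" where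
  "U6n_relations n =
    {(replicate (2 * n) (GenA, False), []), (replicate 3 (GenB, False), []),
     ([(GenA, True), (GenB, False), (GenA, False)], [(GenB, True)])}"

lemma U6n_eq_presented_group: "U6n n = presented_group (U6n_relations n)"
  by (simp add: U6n_def U6n_relations_def Let_def)

definition exponent_sum :: "gen word \<Rightarrow> int" where
  "exponent_sum u = (\<Sum>(x, s)\<leftarrow>u. if x = GenA then (if s then -1 else 1) else 0)"

lemma exponent_sum_simps [simp]:
  "exponent_sum [] = 0"
  "exponent_sum ((x, s) # u) = (if x = GenA then (if s then -1 else 1) else 0) + exponent_sum u"
  "exponent_sum (u @ v) = exponent_sum u + exponent_sum v"
  by (simp_all add: exponent_sum_def)

lemma exponent_sum_replicate [simp]:
  "exponent_sum (replicate k (GenA, False)) = int k"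
  "exponent_sum (replicate k (GenB, s)) = 0"
  by (induction k) auto

lemma exponent_sum_concat_replicate [simp]:
  "exponent_sum (concat (replicate k u)) = int k * exponent_sum u"
  by (induction k) (auto simp: algebra_simps)

lemma exponent_sum_word_inv [simp]: "exponent_sum (word_inv u) = - exponent_sum u"
  by (induction u) (auto simp: word_inv_def)

text \<open>
  Modulo \<open>2n\<close> the exponent sum is the projection to the cyclic quotient by \<open>\<langle>b\<rangle>\<close>. The relations only
  identify words; this invariant is what tells elements apart.
\<close>

lemma word_eq_exponent_sum:
  "word_eq (U6n_relations n) u v \<Longrightarrow> int (2 * n) dvd exponent_sum u - exponent_sum v"
proof (induction rule: word_eq.induct)
  case (word_eq_sym u v)
  then show ?case by (metis dvd_diff_commute)
next
  case (word_eq_trans u v w)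
  then show ?case using dvd_add by fastforce
next
  case (word_eq_relation l r u v)
  then show ?case by (auto simp: U6n_relations_def numeral_3_eq_3)
qed auto

lemma (in group) generator_past_power:
  assumes car: "a \<in> carrier G" "b \<in> carrier G" and rel: "inv a \<otimes> b \<otimes> a = inv b"
  shows "b \<otimes> a [^] (i::nat) = a [^] i \<otimes> (if even i then b else inv b)"
proof (induction i)
  case 0
  then show ?case using car by simp
next
  case (Suc i)
  have "a \<otimes> (inv a \<otimes> b \<otimes> a) = a \<otimes> inv b" using rel by simp
  then have ba: "b \<otimes> a = a \<otimes> inv b" using car by (simp add: m_assoc[symmetric])
  have "inv (inv a \<otimes> b \<otimes> a) = b" using rel car by simp
  then have "inv a \<otimes> (inv b \<otimes> a) = b" using car by (simp add: inv_mult_group m_assoc)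
  then have "a \<otimes> (inv a \<otimes> (inv b \<otimes> a)) = a \<otimes> b" by simp
  then have ba': "inv b \<otimes> a = a \<otimes> b" using car by (simp add: m_assoc[symmetric])
  have "b \<otimes> a [^] Suc i = a [^] i \<otimes> ((if even i then b else inv b) \<otimes> a)"
    using Suc car by (simp add: m_assoc[symmetric])
  also have "\<dots> = a [^] Suc i \<otimes> (if even (Suc i) then b else inv b)"
    using ba ba' car by (simp add: m_assoc)
  finally show ?case .
qed

lemma (in group) odd_power_inverts:
  assumes car: "a \<in> carrier G" "b \<in> carrier G" and rel: "inv a \<otimes> b \<otimes> a = inv b" and i: "odd i"
  shows "b [^] (j::nat) \<otimes> a [^] (i::nat) = a [^] i \<otimes> inv (b [^] j)"
proof (induction j)
  case 0
  then show ?case using car by simp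
next
  case (Suc j)
  have "b [^] Suc j \<otimes> a [^] i = b [^] j \<otimes> a [^] i \<otimes> inv b"
    using generator_past_power[OF car rel, of i] i car by (simp add: m_assoc)
  also have "\<dots> = a [^] i \<otimes> (inv (b [^] j) \<otimes> inv b)" using Suc car by (simp add: m_assoc)
  also have "inv (b [^] j) \<otimes> inv b = inv (b [^] Suc j)"
    using car by (metis inv_mult_group nat_pow_Suc2 nat_pow_closed nat_pow_Suc)
  finally show ?case .
qed

text \<open>
  Put \<open>c = b\<^sup>j\<close>. Since \<open>a\<^sup>i\<close> inverts \<open>c\<close>, conjugating \<open>a\<^sup>i c\<close> by \<open>c\<^sup>-\<^sup>1\<close> gives \<open>a\<^sup>i c\<^sup>3\<close>, and \<open>c\<^sup>3 = 1\<close>.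
\<close>

lemma (in group) odd_normal_form_conjugate_to_power:
  assumes car: "a \<in> carrier G" "b \<in> carrier G" and rel: "inv a \<otimes> b \<otimes> a = inv b"
    and b3: "b [^] (3::nat) = \<one>" and i: "odd i"
  shows "(a [^] (i::nat) \<otimes> b [^] (j::nat), a [^] i) \<in> conjugacy_rel G"
proof -
  define c where "c = b [^] j"
  have c: "c \<in> carrier G" using car by (simp add: c_def)
  have "c \<otimes> c \<otimes> c = c [^] (3::nat)" using c by (simp add: numeral_3_eq_3)
  also have "\<dots> = \<one>" using car b3 by (metis c_def nat_pow_pow mult.commute nat_pow_one)
  finally have c3: "c \<otimes> c \<otimes> c = \<one>" .
  have "c \<otimes> a [^] i = a [^] i \<otimes> inv c" using odd_power_inverts[OF car rel i] by (simp add: c_def)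
  then have "c \<otimes> (a [^] i \<otimes> c) = a [^] i" using c car by (simp add: m_assoc[symmetric]) (simp add: m_assoc)
  then have ac: "inv c \<otimes> a [^] i = a [^] i \<otimes> c" using c car inv_solve_left' by simp
  have "inv c \<otimes> (a [^] i \<otimes> c) \<otimes> inv (inv c) = (inv c \<otimes> a [^] i) \<otimes> c \<otimes> c"
    using c car by (simp add: m_assoc)
  also have "\<dots> = a [^] i \<otimes> (c \<otimes> c \<otimes> c)" unfolding ac using c car by (simp add: m_assoc)
  finally have "a [^] i = inv c \<otimes> (a [^] i \<otimes> c) \<otimes> inv (inv c)" using c3 car by simp
  then have "(a [^] i \<otimes> c, a [^] i) \<in> conjugacy_rel G"
    unfolding conjugacy_rel_def using c car by blast
  then show ?thesis by (simp only: c_def)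
qed

lemma (in group) conjugacy_rel_subset_same_order_rel: "conjugacy_rel G \<subseteq> same_order_rel G"
proof (clarsimp simp: conjugacy_rel_def same_order_rel_def)
  fix g x assume g: "g \<in> carrier G" and x: "x \<in> carrier G"
  have pow: "(x \<otimes> g \<otimes> inv x) [^] (k::nat) = x \<otimes> g [^] k \<otimes> inv x" for k
  proof (induction k)
    case (Suc k)
    have "x \<otimes> g [^] k \<otimes> inv x \<otimes> (x \<otimes> g \<otimes> inv x) = x \<otimes> g [^] k \<otimes> (inv x \<otimes> x) \<otimes> g \<otimes> inv x"
      using g x by (simp only: m_assoc m_closed inv_closed nat_pow_closed)
    then show ?case using Suc g x by (simp add: m_assoc)
  qed (use x in simp)
  have "(x \<otimes> g \<otimes> inv x) [^] k = \<one> \<longleftrightarrow> g [^] k = \<one>" for k :: nat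
  proof
    assume "(x \<otimes> g \<otimes> inv x) [^] k = \<one>"
    then have "inv x \<otimes> (x \<otimes> g [^] k \<otimes> inv x) \<otimes> x = inv x \<otimes> \<one> \<otimes> x" by (simp add: pow)
    then show "g [^] k = \<one>" using g x by (simp add: m_assoc[symmetric]) (simp add: m_assoc)
  qed (use g x in \<open>simp add: pow\<close>)
  then have "ord (x \<otimes> g \<otimes> inv x) dvd k \<longleftrightarrow> ord g dvd k" for k
    using g x by (simp add: pow_eq_id[symmetric])
  then show "ord g = ord (x \<otimes> g \<otimes> inv x)" by (metis dvd_refl dvd_antisym)
qed

context
  fixes n :: nat
  assumes n: "n \<ge> 1"
begin

interpretation group "U6n n" by (rule group_U6n)

abbreviation (input) U where "U \<equiv> U6n n"
abbreviation (input) cls where "cls \<equiv> word_class (U6n_relations n)"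

definition gen_a where "gen_a = cls [(GenA, False)]"
definition gen_b where "gen_b = cls [(GenB, False)]"
text \<open>
  The abelian subgroup of index two. Membership is expressed by the order of the element, so that the
  set is visibly a union of classes of elements of equal order; \<open>cls_in_even_part_iff\<close> below is the
  description by parity.
\<close>

definition even_part where "even_part = {g \<in> carrier U. g [^]\<^bsub>U\<^esub> (3 * n) = \<one>\<^bsub>U\<^esub>}"

lemma cls_mult: "cls u \<otimes>\<^bsub>U\<^esub> cls v = cls (u @ v)"
  by (simp add: U6n_eq_presented_group presented_group_mult)

lemma cls_Nil: "\<one>\<^bsub>U\<^esub> = cls []"
  by (simp add: U6n_eq_presented_group presented_group_def)

lemma carrier_U6n: "carrier U = range cls"
  by (simp add: U6n_eq_presented_group presented_group_def)

lemma cls_pow: "cls u [^]\<^bsub>U\<^esub> k = cls (concat (replicate k u))" for k :: nat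
proof (induction k)
  case (Suc k)
  have "cls u [^]\<^bsub>U\<^esub> Suc k = cls u \<otimes>\<^bsub>U\<^esub> cls u [^]\<^bsub>U\<^esub> k"
    by (rule nat_pow_Suc2) (simp add: carrier_U6n)
  then show ?case by (simp add: Suc cls_mult)
qed (simp add: cls_Nil)

lemma cls_inv: "inv\<^bsub>U\<^esub> cls u = cls (word_inv u)"
  by (rule inv_equality) (auto simp: cls_mult cls_Nil word_class_eq_iff word_inv_left carrier_U6n)

lemma cls_relation: "(l, r) \<in> U6n_relations n \<Longrightarrow> cls l = cls r"
  using word_eq_relation[of l r "U6n_relations n" "[]" "[]"] by (simp add: word_class_eq_iff)

lemma gens:
  "gen_a \<in> carrier U" "gen_b \<in> carrier U"
  "gen_a [^]\<^bsub>U\<^esub> (2 * n) = \<one>\<^bsub>U\<^esub>" "gen_b [^]\<^bsub>U\<^esub> (3::nat) = \<one>\<^bsub>U\<^esub>"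
  "inv\<^bsub>U\<^esub> gen_a \<otimes>\<^bsub>U\<^esub> gen_b \<otimes>\<^bsub>U\<^esub> gen_a = inv\<^bsub>U\<^esub> gen_b"
proof -
  have conc: "concat (replicate k [x]) = replicate k x" for k and x :: "gen \<times> bool"
    by (induction k) auto
  show "gen_a \<in> carrier U" "gen_b \<in> carrier U" by (simp_all add: gen_a_def gen_b_def carrier_U6n)
  show "gen_a [^]\<^bsub>U\<^esub> (2 * n) = \<one>\<^bsub>U\<^esub>" "gen_b [^]\<^bsub>U\<^esub> (3::nat) = \<one>\<^bsub>U\<^esub>"
    by (simp_all only: gen_a_def gen_b_def cls_pow cls_Nil conc)
       (rule cls_relation, simp add: U6n_relations_def)+
  show "inv\<^bsub>U\<^esub> gen_a \<otimes>\<^bsub>U\<^esub> gen_b \<otimes>\<^bsub>U\<^esub> gen_a = inv\<^bsub>U\<^esub> gen_b"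
    unfolding gen_a_def gen_b_def cls_inv cls_mult
    by (rule cls_relation) (simp add: U6n_relations_def word_inv_def)
qed

lemma exponent_sum_cong:
  assumes "cls u = cls v"
  shows "even (exponent_sum u) \<longleftrightarrow> even (exponent_sum v)"
  using word_eq_exponent_sum[of n u v] assms by (auto simp: word_class_eq_iff dest: dvd_mult_left)

text \<open>
  As both generators have finite order, their inverses are powers with a natural exponent. This is
  what brings every word to a normal form with natural exponents, and it fails for \<open>a\<close> when \<open>n = 0\<close>.
\<close>

lemma inv_gen_a: "inv\<^bsub>U\<^esub> gen_a = gen_a [^]\<^bsub>U\<^esub> (2 * n - 1)"
proof (rule inv_equality)
  have "gen_a [^]\<^bsub>U\<^esub> (2 * n - 1) \<otimes>\<^bsub>U\<^esub> gen_a = gen_a [^]\<^bsub>U\<^esub> Suc (2 * n - 1)" by simp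
  also have "Suc (2 * n - 1) = 2 * n" using n by simp
  finally show "gen_a [^]\<^bsub>U\<^esub> (2 * n - 1) \<otimes>\<^bsub>U\<^esub> gen_a = \<one>\<^bsub>U\<^esub>" using gens(3) by simp
qed (use gens in auto)

lemma inv_gen_b: "inv\<^bsub>U\<^esub> gen_b = gen_b [^]\<^bsub>U\<^esub> (2::nat)"
  by (rule inv_equality) (use gens in \<open>auto simp: numeral_2_eq_2 numeral_3_eq_3\<close>)

text \<open>
  Multiplying a normal form from the left by a power of \<open>a\<close> or by \<open>b\<close> gives a normal form again, because
  \<open>b\<close> moves past a power of \<open>a\<close> at the cost of at most an inversion; \<open>b\<^sup>-\<^sup>1 = b\<^sup>2\<close> is two such steps.
\<close>

lemma normal_form_exists: "\<exists>i j. cls u = gen_a [^]\<^bsub>U\<^esub> (i::nat) \<otimes>\<^bsub>U\<^esub> gen_b [^]\<^bsub>U\<^esub> (j::nat)"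
proof (induction u)
  case Nil
  have "cls [] = gen_a [^]\<^bsub>U\<^esub> (0::nat) \<otimes>\<^bsub>U\<^esub> gen_b [^]\<^bsub>U\<^esub> (0::nat)"
    by (simp add: cls_Nil[symmetric])
  then show ?case by blast
next
  case (Cons l u)
  then obtain i j where u: "cls u = gen_a [^]\<^bsub>U\<^esub> (i::nat) \<otimes>\<^bsub>U\<^esub> gen_b [^]\<^bsub>U\<^esub> (j::nat)" by blast
  have a: "\<exists>i' j'. gen_a [^]\<^bsub>U\<^esub> (k::nat) \<otimes>\<^bsub>U\<^esub> cls u = gen_a [^]\<^bsub>U\<^esub> (i'::nat) \<otimes>\<^bsub>U\<^esub> gen_b [^]\<^bsub>U\<^esub> (j'::nat)" for k
  proof -
    have "gen_a [^]\<^bsub>U\<^esub> k \<otimes>\<^bsub>U\<^esub> cls u = gen_a [^]\<^bsub>U\<^esub> (k + i) \<otimes>\<^bsub>U\<^esub> gen_b [^]\<^bsub>U\<^esub> j"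
      using gens by (simp add: u nat_pow_mult[symmetric] m_assoc)
    then show ?thesis by blast
  qed
  have step: "\<exists>k. gen_b \<otimes>\<^bsub>U\<^esub> (gen_a [^]\<^bsub>U\<^esub> i \<otimes>\<^bsub>U\<^esub> gen_b [^]\<^bsub>U\<^esub> (j::nat)) = gen_a [^]\<^bsub>U\<^esub> i \<otimes>\<^bsub>U\<^esub> gen_b [^]\<^bsub>U\<^esub> (k::nat)" for j
  proof -
    obtain m :: nat where m: "(if even i then gen_b else inv\<^bsub>U\<^esub> gen_b) = gen_b [^]\<^bsub>U\<^esub> m"
      using inv_gen_b gens(2) nat_pow_eone by metis
    have "gen_b \<otimes>\<^bsub>U\<^esub> (gen_a [^]\<^bsub>U\<^esub> i \<otimes>\<^bsub>U\<^esub> gen_b [^]\<^bsub>U\<^esub> j) = gen_b \<otimes>\<^bsub>U\<^esub> gen_a [^]\<^bsub>U\<^esub> i \<otimes>\<^bsub>U\<^esub> gen_b [^]\<^bsub>U\<^esub> j"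
      using gens by (simp add: m_assoc)
    also have "\<dots> = gen_a [^]\<^bsub>U\<^esub> i \<otimes>\<^bsub>U\<^esub> gen_b [^]\<^bsub>U\<^esub> (m + j)"
      using gens by (simp only: generator_past_power[OF gens(1,2,5)] m)
        (simp add: m_assoc nat_pow_mult[symmetric])
    finally show ?thesis by blast
  qed
  have b: "\<exists>k. gen_b \<otimes>\<^bsub>U\<^esub> cls u = gen_a [^]\<^bsub>U\<^esub> i \<otimes>\<^bsub>U\<^esub> gen_b [^]\<^bsub>U\<^esub> (k::nat)"
    "\<exists>k. gen_b \<otimes>\<^bsub>U\<^esub> (gen_b \<otimes>\<^bsub>U\<^esub> cls u) = gen_a [^]\<^bsub>U\<^esub> i \<otimes>\<^bsub>U\<^esub> gen_b [^]\<^bsub>U\<^esub> (k::nat)"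
    using step u by metis+
  have cons: "cls (l # u) = cls [l] \<otimes>\<^bsub>U\<^esub> cls u" by (simp add: cls_mult)
  have u_car: "cls u \<in> carrier U" by (simp add: carrier_U6n)
  have "cls [(GenA, True)] = gen_a [^]\<^bsub>U\<^esub> (2 * n - 1)" "cls [(GenB, True)] = gen_b \<otimes>\<^bsub>U\<^esub> gen_b"
    using inv_gen_a inv_gen_b gens(2) by (simp_all add: gen_a_def gen_b_def cls_inv word_inv_def numeral_2_eq_2)
  moreover have "cls [(GenA, False)] = gen_a" "cls [(GenB, False)] = gen_b"
    by (simp_all add: gen_a_def gen_b_def)
  moreover obtain x s where "l = (x, s)" by (cases l)
  ultimately show ?case
    unfolding cons using a a[of 1] b gens(1,2) u_car by (cases x; cases s) (auto simp: m_assoc)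
qed

lemma normal_form:
  assumes "g \<in> carrier U"
  obtains i j where "g = gen_a [^]\<^bsub>U\<^esub> (i::nat) \<otimes>\<^bsub>U\<^esub> gen_b [^]\<^bsub>U\<^esub> (j::nat)"
    "i < 2 * n" "j < 3"
proof -
  obtain i j where ij: "g = gen_a [^]\<^bsub>U\<^esub> (i::nat) \<otimes>\<^bsub>U\<^esub> gen_b [^]\<^bsub>U\<^esub> (j::nat)"
    using assms normal_form_exists unfolding carrier_U6n by blast
  have red: "x [^]\<^bsub>U\<^esub> k = x [^]\<^bsub>U\<^esub> (k mod m)" if "x \<in> carrier U" "x [^]\<^bsub>U\<^esub> m = \<one>\<^bsub>U\<^esub>" for x and k m :: nat
  proof -
    have "x [^]\<^bsub>U\<^esub> k = x [^]\<^bsub>U\<^esub> (m * (k div m) + k mod m)" by simp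
    also have "\<dots> = x [^]\<^bsub>U\<^esub> (k mod m)"
      using that by (simp only: nat_pow_mult[symmetric] nat_pow_pow[symmetric] nat_pow_one l_one nat_pow_closed)
    finally show ?thesis .
  qed
  show thesis
  proof (rule that)
    show "g = gen_a [^]\<^bsub>U\<^esub> (i mod (2 * n)) \<otimes>\<^bsub>U\<^esub> gen_b [^]\<^bsub>U\<^esub> (j mod 3)"
      using red[OF gens(1,3), of i] red[OF gens(2,4), of j] ij by simp
  qed (use n in auto)
qed

lemma finite_U6n: "finite (carrier U)"
proof (rule finite_subset)
  show "carrier U \<subseteq> (\<lambda>(i, j). gen_a [^]\<^bsub>U\<^esub> i \<otimes>\<^bsub>U\<^esub> gen_b [^]\<^bsub>U\<^esub> j) ` ({..<2 * n} \<times> {..<3::nat})"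
    by (auto elim!: normal_form)
qed auto

lemma even_power_commutes:
  assumes "even i"
  shows "gen_b [^]\<^bsub>U\<^esub> (j::nat) \<otimes>\<^bsub>U\<^esub> gen_a [^]\<^bsub>U\<^esub> (i::nat) = gen_a [^]\<^bsub>U\<^esub> i \<otimes>\<^bsub>U\<^esub> gen_b [^]\<^bsub>U\<^esub> j"
  by (rule group_commutes_pow) (use generator_past_power[OF gens(1,2,5), of i] assms gens in auto)

lemma exponent_sum_normal_form:
  assumes "cls u = gen_a [^]\<^bsub>U\<^esub> (i::nat) \<otimes>\<^bsub>U\<^esub> gen_b [^]\<^bsub>U\<^esub> (j::nat)"
  shows "even (exponent_sum u) \<longleftrightarrow> even i"
proof -
  have "cls u = cls (concat (replicate i [(GenA, False)]) @ concat (replicate j [(GenB, False)]))"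
    using assms by (simp only: gen_a_def gen_b_def cls_pow cls_mult)
  from exponent_sum_cong[OF this] show ?thesis by simp
qed

text \<open>
  If \<open>g\<^sup>3\<^sup>n = 1\<close> for an element with exponent sum \<open>e\<close>, then \<open>2n\<close> divides \<open>3n e\<close>, so \<open>e\<close> is even. Conversely,
  an even power \<open>a\<^sup>2\<^sup>k\<close> commutes with \<open>b\<close>, hence
  \<open>(a\<^sup>2\<^sup>k b\<^sup>j)\<^sup>3\<^sup>n = (a\<^sup>2\<^sup>n)\<^sup>3\<^sup>k (b\<^sup>3)\<^sup>j\<^sup>n = 1\<close>.
\<close>

lemma cls_in_even_part_iff: "cls u \<in> even_part \<longleftrightarrow> even (exponent_sum u)"
proof
  assume "cls u \<in> even_part"
  then have "cls (concat (replicate (3 * n) u)) = cls []"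
    by (simp add: even_part_def cls_pow cls_Nil)
  then have "int (2 * n) dvd int (3 * n) * exponent_sum u"
    using word_eq_exponent_sum by (fastforce simp: word_class_eq_iff)
  then have "int n * 2 dvd int n * (3 * exponent_sum u)" by (simp add: ac_simps)
  then have "2 dvd 3 * exponent_sum u" using n by (simp only: dvd_mult_cancel_left) simp
  then show "even (exponent_sum u)" by simp
next
  assume even: "even (exponent_sum u)"
  obtain i j where ij: "cls u = gen_a [^]\<^bsub>U\<^esub> (i::nat) \<otimes>\<^bsub>U\<^esub> gen_b [^]\<^bsub>U\<^esub> (j::nat)"
    using normal_form_exists by blast
  then have "even i" using exponent_sum_normal_form even by blast
  then obtain k where k: "i = 2 * k" by blast
  have "(gen_a [^]\<^bsub>U\<^esub> i) [^]\<^bsub>U\<^esub> (3 * n) = (gen_a [^]\<^bsub>U\<^esub> (2 * n)) [^]\<^bsub>U\<^esub> (3 * k)"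
    using gens(1) by (simp add: nat_pow_pow k ac_simps)
  moreover have "(gen_b [^]\<^bsub>U\<^esub> j) [^]\<^bsub>U\<^esub> (3 * n) = (gen_b [^]\<^bsub>U\<^esub> (3::nat)) [^]\<^bsub>U\<^esub> (j * n)"
    using gens(2) by (simp add: nat_pow_pow ac_simps)
  moreover have "(gen_a [^]\<^bsub>U\<^esub> i \<otimes>\<^bsub>U\<^esub> gen_b [^]\<^bsub>U\<^esub> j) [^]\<^bsub>U\<^esub> (3 * n)
      = (gen_a [^]\<^bsub>U\<^esub> i) [^]\<^bsub>U\<^esub> (3 * n) \<otimes>\<^bsub>U\<^esub> (gen_b [^]\<^bsub>U\<^esub> j) [^]\<^bsub>U\<^esub> (3 * n)"
    by (rule pow_mult_distrib) (use even_power_commutes[OF \<open>even i\<close>] gens in auto)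
  ultimately show "cls u \<in> even_part"
    using gens by (simp add: even_part_def ij nat_pow_one)
qed

lemma even_part_subset: "even_part \<subseteq> carrier U"
  by (auto simp: even_part_def)

lemma normal_form_in_even_part_iff:
  "gen_a [^]\<^bsub>U\<^esub> (i::nat) \<otimes>\<^bsub>U\<^esub> gen_b [^]\<^bsub>U\<^esub> (j::nat) \<in> even_part \<longleftrightarrow> even i"
proof -
  have "gen_a [^]\<^bsub>U\<^esub> i \<otimes>\<^bsub>U\<^esub> gen_b [^]\<^bsub>U\<^esub> j \<in> range cls"
    using gens by (simp flip: carrier_U6n)
  then obtain u where "gen_a [^]\<^bsub>U\<^esub> i \<otimes>\<^bsub>U\<^esub> gen_b [^]\<^bsub>U\<^esub> j = cls u" by blast
  then show ?thesis using cls_in_even_part_iff exponent_sum_normal_form by metis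
qed

lemma even_part_abelian:
  assumes "g \<in> even_part" "h \<in> even_part"
  shows "g \<otimes>\<^bsub>U\<^esub> h = h \<otimes>\<^bsub>U\<^esub> g"
proof -
  obtain i j where g: "g = gen_a [^]\<^bsub>U\<^esub> (i::nat) \<otimes>\<^bsub>U\<^esub> gen_b [^]\<^bsub>U\<^esub> (j::nat)"
    using assms even_part_subset by (blast elim: normal_form)
  obtain k l where h: "h = gen_a [^]\<^bsub>U\<^esub> (k::nat) \<otimes>\<^bsub>U\<^esub> gen_b [^]\<^bsub>U\<^esub> (l::nat)"
    using assms even_part_subset by (blast elim: normal_form)
  have "even i" "even k" using assms normal_form_in_even_part_iff g h by blast+
  have collect: "(gen_a [^]\<^bsub>U\<^esub> (p::nat) \<otimes>\<^bsub>U\<^esub> gen_b [^]\<^bsub>U\<^esub> (q::nat)) \<otimes>\<^bsub>U\<^esub> (gen_a [^]\<^bsub>U\<^esub> r \<otimes>\<^bsub>U\<^esub> gen_b [^]\<^bsub>U\<^esub> (s::nat))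
      = gen_a [^]\<^bsub>U\<^esub> (p + r) \<otimes>\<^bsub>U\<^esub> gen_b [^]\<^bsub>U\<^esub> (q + s)" if "even r" for p q r s :: nat
  proof -
    have "(gen_a [^]\<^bsub>U\<^esub> p \<otimes>\<^bsub>U\<^esub> gen_b [^]\<^bsub>U\<^esub> q) \<otimes>\<^bsub>U\<^esub> (gen_a [^]\<^bsub>U\<^esub> r \<otimes>\<^bsub>U\<^esub> gen_b [^]\<^bsub>U\<^esub> s)
      = gen_a [^]\<^bsub>U\<^esub> p \<otimes>\<^bsub>U\<^esub> (gen_b [^]\<^bsub>U\<^esub> q \<otimes>\<^bsub>U\<^esub> gen_a [^]\<^bsub>U\<^esub> r) \<otimes>\<^bsub>U\<^esub> gen_b [^]\<^bsub>U\<^esub> s"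
      using gens by (simp add: m_assoc)
    also have "\<dots> = gen_a [^]\<^bsub>U\<^esub> (p + r) \<otimes>\<^bsub>U\<^esub> gen_b [^]\<^bsub>U\<^esub> (q + s)"
      unfolding even_power_commutes[OF that] using gens by (simp add: m_assoc nat_pow_mult[symmetric])
    finally show ?thesis .
  qed
  show ?thesis unfolding g h collect[OF \<open>even i\<close>] collect[OF \<open>even k\<close>] by (simp add: add.commute)
qed

lemma even_part_index2:
  assumes "g \<in> carrier U - even_part" "h \<in> carrier U - even_part"
  shows "inv\<^bsub>U\<^esub> g \<otimes>\<^bsub>U\<^esub> h \<in> even_part"
proof -
  obtain u v where "g = cls u" "h = cls v" using assms by (auto simp: carrier_U6n)
  then show ?thesis using assms by (simp add: cls_inv cls_mult cls_in_even_part_iff)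
qed

lemma even_part_same_order:
  assumes "(g, h) \<in> same_order_rel U"
  shows "g \<in> even_part \<longleftrightarrow> h \<in> even_part"
  using assms by (auto simp: same_order_rel_def even_part_def pow_eq_id)

text \<open>
  Once \<open>B\<close> contains conjugacy, each class outside the even part contains a power of \<open>a\<close>. Powers of
  \<open>a\<close> commute, so any two elements outside the even part are adjacent. Refining equality of
  orders keeps the classes from crossing the border of the even part.
\<close>

lemma hansen_vukicevic_U6n_coarse:
  assumes "conjugacy_rel U \<subseteq> B" "B \<subseteq> same_order_rel U"
  defines "\<Gamma> \<equiv> super_commuting_graph U B"
  shows "real (zagreb2 \<Gamma>) / real (card (edges \<Gamma>)) \<ge> real (zagreb1 \<Gamma>) / real (card (vertices \<Gamma>))"
  unfolding \<Gamma>_def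
proof (rule hansen_vukicevic_super_commuting_graph[OF finite_U6n even_part_subset even_part_abelian even_part_index2])
  have power: "\<exists>i. (g, gen_a [^]\<^bsub>U\<^esub> (i::nat)) \<in> B" if g: "g \<in> carrier U - even_part" for g
  proof -
    obtain i j where ij: "g = gen_a [^]\<^bsub>U\<^esub> (i::nat) \<otimes>\<^bsub>U\<^esub> gen_b [^]\<^bsub>U\<^esub> (j::nat)"
      using g by (blast elim: normal_form)
    then have "odd i" using g normal_form_in_even_part_iff by blast
    then show ?thesis
      using odd_normal_form_conjugate_to_power[OF gens(1,2,5,4)] ij assms(1) by blast
  qed
  fix g h k
  assume g: "g \<in> carrier U - even_part" and k: "k \<in> carrier U - even_part"
  show "class_commuting U B g k"
    using power[OF g] power[OF k] gens(1) nat_pow_comm unfolding class_commuting_def by blast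
next
  fix g assume g: "g \<in> carrier U"
  then have "(g, g) \<in> conjugacy_rel U" by (auto simp: conjugacy_rel_def intro!: bexI[of _ "\<one>\<^bsub>U\<^esub>"])
  then show "(g, g) \<in> B" using assms(1) by blast
next
  show "B \<subseteq> carrier U \<times> carrier U" using assms(2) by (auto simp: same_order_rel_def)
  show "g \<in> even_part \<longleftrightarrow> h \<in> even_part" if "(g, h) \<in> B" for g h
    using even_part_same_order that assms(2) by blast
qed

lemmas hansen_vukicevic_U6n_ESCom =
  hansen_vukicevic_ESCom[OF finite_U6n even_part_subset even_part_abelian even_part_index2]

end

theorem theorem3p7:
  fixes n :: nat
  assumes "n \<ge> 1"
  shows "\<forall>\<Gamma>\<in>{ESCom (U6n n), CSCom (U6n n), OSCom (U6n n)}.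
           real (zagreb2 \<Gamma>) / real (card (edges \<Gamma>))
             \<ge> real (zagreb1 \<Gamma>) / real (card (vertices \<Gamma>))"
  using hansen_vukicevic_U6n_ESCom[OF assms]
    hansen_vukicevic_U6n_coarse[OF assms order_refl group.conjugacy_rel_subset_same_order_rel[OF group_U6n]]
    hansen_vukicevic_U6n_coarse[OF assms group.conjugacy_rel_subset_same_order_rel[OF group_U6n] order_refl]
  by (simp add: CSCom_def OSCom_def)

end
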